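(* Any $2n$-dimensional $d$-th order conjugate super-symmetric tensor $\mathcal{F}\in\mathbb{C}^{(2n)^d}$ uniquely defines, under the map $\mathbf{G}$, an $n$-dimensional $d$-th degree real-valued general conjugate form, and vice versa under $\mathbf{G}^{-1}$. That is, if $\mathcal{F}$ is conjugate super-symmetric then $\mathbf{G}(\mathcal{F})$ is a real-valued general conjugate form, and if $f_G$ is a real-valued general conjugate form then $\mathbf{G}^{-1}(f_G)$ is conjugate super-symmetric.
   Context: A general conjugate form of degree $d$ in $\boldsymbol{x}\in\mathbb{C}^n$ is a function $$f_G(\boldsymbol{x})=\sum_{k=0}^d \ \sum_{1\le i_1\le \dots \le i_k \le n}\ \sum_{1\le j_1 \le \dots \le j_{d-k} \le n} a_{i_1\dots i_k,j_1\dots j_{d-k}}\,\overline{x_{i_1}\cdots x_{i_k}}\,x_{j_1} \cdots x_{j_{d-k}}$$ with complex coefficients (index lists may be empty). It is real-valued if $f_G(\boldsymbol{x})\in\mathbb{R}$ for all $\boldsymbol{x}\in\mathbb{C}^n$. A tensor $\mathcal{F}\in\mathbb{C}^{(2n)^d}$ is symmetric if its entries $\mathcal{F}_{i_1\dots i_d}$ are invariant under all permutations of the indices (no conjugation involved). It is conjugate super-symmetric if (i) $\mathcal{F}$ is symmetric, and (ii) $\mathcal{F}_{i_1\dots i_d} = \overline{\mathcal{F}_{j_1\dots j_d }}$ for all $1\le i_1, \dots, i_d, j_1,\dots, j_d\le 2n$ with $|i_k -j_k| = n$ for $k=1,\dots,d$. For a tensor $\mathcal{F}\in\mathbb{C}^{(2n)^d}$,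 $\mathcal{F}(\boldsymbol{z}^1,\dots,\boldsymbol{z}^d)=\sum_{i_1,\dots,i_d=1}^{2n}\mathcal{F}_{i_1\dots i_d}z^1_{i_1}\cdots z^d_{i_d}$ is its multilinear form. The bijection $\mathbf{G}$ from symmetric tensors in $\mathbb{C}^{(2n)^d}$ to general conjugate forms of degree $d$ in $\boldsymbol{x}\in\mathbb{C}^n$ is $$\mathbf{G}(\mathcal{F})(\boldsymbol{x})=\mathcal{F}\bigg(\underbrace{\binom{\overline{\boldsymbol{x}}}{\boldsymbol{x}},\dots,\binom{\overline{\boldsymbol{x}}}{\boldsymbol{x}}}_d\bigg).$$ Its inverse $\mathcal{F}=\mathbf{G}^{-1}(f_G)$ is given as follows: for $1\le j_1,\dots,j_d\le 2n$, sort them as $1\le j_{i_1}\le\dots\le j_{i_d}\le 2n$, let $k$ be the number of these indices that are $\le n$, and set $$\mathcal{F}_{j_1\dots j_d} = \frac{a_{j_{i_1}\dots j_{i_k},(j_{i_{k+1}}-n)\dots (j_{i_d}-n)}}{|\Pi(j_1\dots j_d)|},$$ where $\Pi(j_1\dots j_d)$ is the set of all distinct permutations of the indices $j_1,\dots,j_d$. *)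

theory Defs
  imports Complex_Main "HOL-Library.FuncSet" "HOL-Combinatorics.Combinatorics"
begin

definition index_tuples :: "nat \<Rightarrow> nat \<Rightarrow> nat list set" where
  "index_tuples m d = {js. length js = d \<and> set js \<subseteq> {1..m}}"

definition sorted_tuples :: "nat \<Rightarrow> nat \<Rightarrow> nat list set" where
  "sorted_tuples m d = {js \<in> index_tuples m d. sorted js}"

text \<open>
  Vectors, tensors, coefficient families and forms are functions on explicit carriers
  (coordinates are numbered from 1). All of them are extensional, so that HOL equality is
  equality of the mathematical objects.
\<close>

definition cvecs :: "nat \<Rightarrow> (nat \<Rightarrow> complex) set" where
  "cvecs n = ({1..n} \<rightarrow>\<^sub>E UNIV)"

definition tensors :: "nat \<Rightarrow> nat \<Rightarrow> (nat list \<Rightarrow> complex) set" where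
  "tensors m d = (index_tuples m d \<rightarrow>\<^sub>E UNIV)"

definition multilinear_form ::
    "nat \<Rightarrow> (nat list \<Rightarrow> complex) \<Rightarrow> (nat \<Rightarrow> complex) list \<Rightarrow> complex" where
  "multilinear_form m F zs =
     (\<Sum>js \<in> index_tuples m (length zs). F js * (\<Prod>k<length zs. (zs ! k) (js ! k)))"

definition symmetric_tensor :: "nat \<Rightarrow> nat \<Rightarrow> (nat list \<Rightarrow> complex) \<Rightarrow> bool" where
  "symmetric_tensor m d F \<longleftrightarrow>
     F \<in> tensors m d \<and>
     (\<forall>js \<in> index_tuples m d. \<forall>p. p permutes {..<d} \<longrightarrow> F (permute_list p js) = F js)"

definition conj_super_symmetric :: "nat \<Rightarrow> nat \<Rightarrow> (nat list \<Rightarrow> complex) \<Rightarrow> bool" where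
  "conj_super_symmetric n d F \<longleftrightarrow>
     symmetric_tensor (2 * n) d F \<and>
     (\<forall>is \<in> index_tuples (2 * n) d. \<forall>js \<in> index_tuples (2 * n) d.
        (\<forall>k<d. \<bar>int (is ! k) - int (js ! k)\<bar> = int n) \<longrightarrow> F is = cnj (F js))"

text \<open>A coefficient is indexed by the pair (conjugated indices, unconjugated indices).\<close>

definition coeff_families :: "nat \<Rightarrow> nat \<Rightarrow> (nat list \<times> nat list \<Rightarrow> complex) set" where
  "coeff_families n d =
     ((\<Union>k\<in>{0..d}. sorted_tuples n k \<times> sorted_tuples n (d - k)) \<rightarrow>\<^sub>E UNIV)"

definition conj_form ::
    "nat \<Rightarrow> nat \<Rightarrow> (nat list \<times> nat list \<Rightarrow> complex) \<Rightarrow> (nat \<Rightarrow> complex) \<Rightarrow> complex" where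
  "conj_form n d a =
     (\<lambda>x \<in> cvecs n. \<Sum>k=0..d. \<Sum>is \<in> sorted_tuples n k. \<Sum>js \<in> sorted_tuples n (d - k).
        a (is, js) * cnj (prod_list (map x is)) * prod_list (map x js))"

definition general_conj_form :: "nat \<Rightarrow> nat \<Rightarrow> ((nat \<Rightarrow> complex) \<Rightarrow> complex) \<Rightarrow> bool" where
  "general_conj_form n d f \<longleftrightarrow> (\<exists>a \<in> coeff_families n d. f = conj_form n d a)"

definition real_valued_form :: "nat \<Rightarrow> ((nat \<Rightarrow> complex) \<Rightarrow> complex) \<Rightarrow> bool" where
  "real_valued_form n f \<longleftrightarrow> (\<forall>x \<in> cvecs n. f x \<in> \<real>)"

definition conj_stack :: "nat \<Rightarrow> (nat \<Rightarrow> complex) \<Rightarrow> nat \<Rightarrow> complex" where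
  "conj_stack n x = (\<lambda>i \<in> {1..2 * n}. if i \<le> n then cnj (x i) else x (i - n))"

definition form_of_tensor ::
    "nat \<Rightarrow> nat \<Rightarrow> (nat list \<Rightarrow> complex) \<Rightarrow> (nat \<Rightarrow> complex) \<Rightarrow> complex" where
  "form_of_tensor n d F =
     (\<lambda>x \<in> cvecs n. multilinear_form (2 * n) F (replicate d (conj_stack n x)))"

text \<open>
  The coefficients are determined by the form as a function, because the monomials in the
  coordinates and their conjugates are linearly independent functions; hence the definite
  description below.
\<close>

definition form_coeffs ::
    "nat \<Rightarrow> nat \<Rightarrow> ((nat \<Rightarrow> complex) \<Rightarrow> complex) \<Rightarrow> nat list \<times> nat list \<Rightarrow> complex" where
  "form_coeffs n d f = (THE a. a \<in> coeff_families n d \<and> f = conj_form n d a)"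

definition tensor_of_form ::
    "nat \<Rightarrow> nat \<Rightarrow> ((nat \<Rightarrow> complex) \<Rightarrow> complex) \<Rightarrow> nat list \<Rightarrow> complex" where
  "tensor_of_form n d f =
     (\<lambda>js \<in> index_tuples (2 * n) d.
        let s = sort js; k = length (filter (\<lambda>j. j \<le> n) js)
        in form_coeffs n d f (take k s, map (\<lambda>j. j - n) (drop k s))
             / of_nat (card (permutations_of_multiset (mset js))))"

end

theory Submission
  imports Defs
begin

text \<open>
  Both directions rest on one bijection and one symmetry.

  The bijection is between all symmetric tensors and all general conjugate forms. Concatenating
  the conjugated indices with the unconjugated ones shifted by \<open>n\<close> identifies the index pairs of
  a coefficient family with the sorted \<open>d\<close>-tuples over \<open>{1..2 * n}\<close>, so a conjugate form is a
  linear combination of the monomials \<open>z_{s_1} \<cdots> z_{s_d}\<close>, \<open>s\<close> sorted, in the stacked vector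
  \<open>z = (cnj x, x)\<close> (\<open>conj_form_eq_sum_monomials\<close>). The form of a symmetric tensor becomes such a
  combination after collecting the rearrangements of each sorted tuple, which multiplies the
  entry by the number of distinct permutations (\<open>form_of_symmetric_tensor\<close>). What makes this
  reversible is that the coefficients are determined by the values of the form: each monomial is
  a multiplicative function of \<open>x\<close>, distinct monomials are distinct functions, and distinct
  characters of a monoid are linearly independent by Dedekind's argument
  (\<open>characters_linearly_independent\<close>, \<open>monomials_linearly_independent\<close>).

  The symmetry is complex conjugation. It exchanges the two halves of \<open>z\<close>, so the conjugate of
  the form of \<open>F\<close> is the form of the tensor obtained from \<open>F\<close> by conjugating the entries and
  exchanging \<open>i\<close> with \<open>i + n\<close> in every index (\<open>form_of_conj_tensor\<close>). Conjugate super-symmetry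
  says that a symmetric \<open>F\<close> is fixed by this operation; being real-valued says that its form is
  fixed. Since symmetric tensors are determined by their forms, the two conditions are equivalent
  (\<open>real_valued_form_iff\<close>).
\<close>

section \<open>Linear independence of characters\<close>

text \<open>
  Dedekind's argument: a relation of minimal length between multiplicative functions can be
  shortened by comparing it at a product \<open>m y x\<close> with a multiple of itself at \<open>x\<close>. Only the
  products of elements of \<open>X\<close> matter, so \<open>m\<close> may be any operation that preserves \<open>X\<close>.
\<close>

lemma characters_linearly_independent:
  fixes \<chi> :: "'i \<Rightarrow> 'a \<Rightarrow> 'b::field"
  assumes "finite S"
    and unit: "e \<in> X" "\<And>s. s \<in> S \<Longrightarrow> \<chi> s e = 1"
    and closed: "\<And>x y. x \<in> X \<Longrightarrow> y \<in> X \<Longrightarrow> m x y \<in> X"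
    and mult: "\<And>s x y. s \<in> S \<Longrightarrow> x \<in> X \<Longrightarrow> y \<in> X \<Longrightarrow> \<chi> s (m x y) = \<chi> s x * \<chi> s y"
    and distinct: "\<And>s t. s \<in> S \<Longrightarrow> t \<in> S \<Longrightarrow> s \<noteq> t \<Longrightarrow> \<exists>x\<in>X. \<chi> s x \<noteq> \<chi> t x"
    and vanish: "\<And>x. x \<in> X \<Longrightarrow> (\<Sum>s\<in>S. c s * \<chi> s x) = 0"
    and "s \<in> S"
  shows "c s = 0"
  using assms(1,3,5-8)
proof (induction S arbitrary: c s rule: finite_induct)
  case (insert t S)
  have zero: "c r = 0" if r: "r \<in> S" for r
  proof -
    have "r \<noteq> t" using r insert.hyps by auto
    then obtain y where y: "y \<in> X" "\<chi> r y \<noteq> \<chi> t y"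
      using insert.prems(3)[of r t] r by auto
    \<comment> \<open>Compare the relation at \<open>m y x\<close> with \<open>\<chi> t y\<close> times the relation at \<open>x\<close>: the term of \<open>t\<close> cancels.\<close>
    have "c r * (\<chi> r y - \<chi> t y) = 0"
    proof (rule insert.IH[where c = "\<lambda>s. c s * (\<chi> s y - \<chi> t y)" and s = r])
      fix x assume x: "x \<in> X"
      have "(\<Sum>s\<in>S. (c s * (\<chi> s y - \<chi> t y)) * \<chi> s x)
          = (\<Sum>s\<in>insert t S. c s * \<chi> s (m y x)) - \<chi> t y * (\<Sum>s\<in>insert t S. c s * \<chi> s x)"
        using insert.hyps x y
        by (simp add: insert.prems(2) algebra_simps sum_subtractf sum_distrib_left)
      also have "\<dots> = 0"
        using insert.prems(4)[OF x] insert.prems(4)[OF closed[OF y(1) x]] by simp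
      finally show "(\<Sum>s\<in>S. (c s * (\<chi> s y - \<chi> t y)) * \<chi> s x) = 0" .
    qed (use insert.prems r in auto)
    with y show ?thesis by simp
  qed
  moreover have "c t = 0"
    using insert.prems(4)[OF unit(1)] insert.prems(1)[of t] insert.hyps zero by simp
  ultimately show ?case using insert.prems(5) by auto
qed simp

section \<open>Monomials in the coordinates and their conjugates\<close>

definition monomial :: "nat \<Rightarrow> nat list \<Rightarrow> (nat \<Rightarrow> complex) \<Rightarrow> complex" where
  "monomial n js x = prod_list (map (conj_stack n x) js)"

lemma finite_index_tuples: "finite (index_tuples m d)"
  using finite_lists_length_eq[of "{1..m}" d] by (simp add: index_tuples_def conj_commute)

lemma finite_sorted_tuples: "finite (sorted_tuples m d)"
  using finite_index_tuples[of m d] by (simp add: sorted_tuples_def)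

lemma sorted_tuples_sorted: "s \<in> sorted_tuples m d \<Longrightarrow> sorted s"
  by (simp add: sorted_tuples_def)

lemma monomial_cong_mset: "mset is = mset js \<Longrightarrow> monomial n is = monomial n js"
  unfolding monomial_def by (metis mset_map prod_mset_prod_list)

text \<open>
  For \<open>m \<noteq> 0\<close> the \<open>m\<close>-th powers of an \<open>m\<close>-th root of \<open>\<i>\<close> and of its conjugate differ.
\<close>

lemma cnj_pow_eq_pow_imp_zero:
  assumes "\<And>c::complex. c \<noteq> 0 \<Longrightarrow> cnj c ^ m = c ^ m"
  shows "m = 0"
proof (rule ccontr)
  assume "m \<noteq> 0"
  define c where "c = cis (pi / (2 * real m))"
  have "c ^ m = \<i>"
    using \<open>m \<noteq> 0\<close> by (simp add: c_def DeMoivre)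
  moreover have "cnj (c ^ m) = c ^ m"
    using assms[of c] by (simp add: c_def)
  ultimately have "cnj \<i> = \<i>" by (simp only:)
  then show False by (simp add: complex_eq_iff)
qed

text \<open>
  The value at \<open>2\<close> gives the total degree. With equal total degrees one side has \<open>u\<close> more
  conjugated factors than the other and \<open>u\<close> fewer plain ones, and cancelling the common factors
  leaves \<open>cnj c ^ u = c ^ u\<close>.
\<close>

lemma cnj_pow_mult_pow_inj:
  assumes eq: "\<And>c::complex. c \<noteq> 0 \<Longrightarrow> cnj c ^ p * c ^ q = cnj c ^ p' * c ^ q'"
  shows "p = p' \<and> q = q'"
proof -
  have "(2::complex) ^ (p + q) = 2 ^ (p' + q')"
    using eq[of 2] by (simp add: power_add)
  then have "norm ((2::complex) ^ (p + q)) = norm ((2::complex) ^ (p' + q'))" by (rule arg_cong)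
  then have "(2::real) ^ (p + q) = 2 ^ (p' + q')" by (simp only: norm_power norm_numeral)
  then have deg: "p + q = p' + q'" by simp
  have *: "u = 0"
    if u: "\<And>c::complex. c \<noteq> 0 \<Longrightarrow> cnj c ^ (r + u) * c ^ v = cnj c ^ r * c ^ (v + u)" for r u v
  proof (rule cnj_pow_eq_pow_imp_zero)
    fix c :: complex assume c: "c \<noteq> 0"
    have "(cnj c ^ r * c ^ v) * cnj c ^ u = (cnj c ^ r * c ^ v) * c ^ u"
      using u[OF c] by (simp only: power_add mult_ac)
    moreover have "cnj c ^ r * c ^ v \<noteq> 0" using c by simp
    ultimately show "cnj c ^ u = c ^ u" by (metis mult_left_cancel)
  qed
  show ?thesis
  proof (cases "p \<le> p'")
    case True
    then obtain u where p': "p' = p + u" by (rule less_eqE)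
    with deg have q: "q = q' + u" by simp
    have "u = 0" by (rule *) (rule eq[unfolded p' q, symmetric])
    with p' q show ?thesis by simp
  next
    case False
    then have "p' \<le> p" by simp
    then obtain u where p: "p = p' + u" by (rule less_eqE)
    with deg have q': "q' = q + u" by simp
    have "u = 0" by (rule *) (rule eq[unfolded p q'])
    with p q' show ?thesis by simp
  qed
qed

definition pointwise_mult :: "nat \<Rightarrow> (nat \<Rightarrow> complex) \<Rightarrow> (nat \<Rightarrow> complex) \<Rightarrow> nat \<Rightarrow> complex" where
  "pointwise_mult n x y = (\<lambda>i\<in>{1..n}. x i * y i)"

lemma monomial_pointwise_mult:
  assumes "set js \<subseteq> {1..2 * n}"
  shows "monomial n js (pointwise_mult n x y) = monomial n js x * monomial n js y"
  using assms
  by (induction js) (auto simp: monomial_def conj_stack_def pointwise_mult_def)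

lemma monomial_ones:
  assumes "set js \<subseteq> {1..2 * n}"
  shows "monomial n js (\<lambda>i\<in>{1..n}. 1) = 1"
  using assms by (induction js) (auto simp: monomial_def conj_stack_def)

text \<open>
  Test vectors that isolate the exponents of one coordinate and of its conjugate.
\<close>

lemma monomial_one_variable:
  assumes "set js \<subseteq> {1..2 * n}" "i \<in> {1..n}"
  shows "monomial n js (\<lambda>l\<in>{1..n}. if l = i then c else 1)
       = cnj c ^ count (mset js) i * c ^ count (mset js) (i + n)"
  using assms by (induction js) (auto simp: monomial_def conj_stack_def)

lemma monomial_distinct:
  assumes s: "s \<in> sorted_tuples (2 * n) d" and t: "t \<in> sorted_tuples (2 * n) d" and "s \<noteq> t"
  shows "\<exists>x\<in>cvecs n. monomial n s x \<noteq> monomial n t x"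
proof (rule ccontr)
  assume "\<not> ?thesis"
  then have eq: "monomial n s x = monomial n t x" if "x \<in> cvecs n" for x using that by blast
  have sets: "set s \<subseteq> {1..2 * n}" "set t \<subseteq> {1..2 * n}"
    using s t by (auto simp: sorted_tuples_def index_tuples_def)
  have counts: "count (mset s) i = count (mset t) i \<and> count (mset s) (i + n) = count (mset t) (i + n)"
    if i: "i \<in> {1..n}" for i
  proof (rule cnj_pow_mult_pow_inj)
    fix c :: complex
    show "cnj c ^ count (mset s) i * c ^ count (mset s) (i + n)
        = cnj c ^ count (mset t) i * c ^ count (mset t) (i + n)"
      unfolding monomial_one_variable[OF sets(1) i, symmetric] monomial_one_variable[OF sets(2) i, symmetric]
      by (rule eq) (simp add: cvecs_def)
  qed
  have "mset s = mset t"
  proof (rule multiset_eqI)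
    fix j
    consider "j \<in> {1..n}" | i where "i \<in> {1..n}" "j = i + n" | "j \<notin> {1..2 * n}"
    proof (cases "j \<in> {1..2 * n} \<and> n < j")
      case True
      then have "j - n \<in> {1..n}" "j = (j - n) + n" by auto
      then show ?thesis by (rule that(2))
    next
      case False
      then have "j \<in> {1..n} \<or> j \<notin> {1..2 * n}" by auto
      then show ?thesis using that by blast
    qed
    then show "count (mset s) j = count (mset t) j"
    proof cases
      case 1
      then show ?thesis using counts by blast
    next
      case (2 i)
      then show ?thesis using counts[of i] by blast
    next
      case 3
      then have "j \<notin> set s" "j \<notin> set t" using sets by auto
      then show ?thesis by (metis count_mset_0_iff)
    qed
  qed
  then have "s = t"
    using s t by (metis (no_types, lifting) mem_Collect_eq properties_for_sort sorted_tuples_def)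
  with \<open>s \<noteq> t\<close> show False ..
qed

text \<open>
  The coordinate vectors form a monoid under the pointwise product, on which every monomial is a
  character.
\<close>

lemma monomials_linearly_independent:
  assumes vanish: "\<And>x. x \<in> cvecs n \<Longrightarrow> (\<Sum>s\<in>sorted_tuples (2 * n) d. c s * monomial n s x) = 0"
    and s: "s \<in> sorted_tuples (2 * n) d"
  shows "c s = 0"
proof (rule characters_linearly_independent[where \<chi> = "monomial n" and X = "cvecs n"
      and e = "\<lambda>i\<in>{1..n}. 1" and m = "pointwise_mult n", OF finite_sorted_tuples])
  have sets: "set t \<subseteq> {1..2 * n}" if "t \<in> sorted_tuples (2 * n) d" for t
    using that by (auto simp: sorted_tuples_def index_tuples_def)
  show "(\<lambda>i\<in>{1..n}. 1) \<in> cvecs n" by (simp add: cvecs_def)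
  show "pointwise_mult n x y \<in> cvecs n" for x y by (simp add: cvecs_def pointwise_mult_def)
  show "monomial n t (\<lambda>i\<in>{1..n}. 1) = 1" if "t \<in> sorted_tuples (2 * n) d" for t
    using sets[OF that] by (rule monomial_ones)
  show "monomial n t (pointwise_mult n x y) = monomial n t x * monomial n t y"
    if "t \<in> sorted_tuples (2 * n) d" for t x y
    using sets[OF that] by (rule monomial_pointwise_mult)
qed (use monomial_distinct vanish s in auto)

section \<open>Conjugate forms as combinations of monomials\<close>

text \<open>
  The passage from a sorted tuple over \<open>{1..2 * n}\<close> to the index pair of its coefficient, cut as
  in the formula for the inverse of \<open>form_of_tensor\<close>; \<open>join_index\<close> is the way back.
\<close>

definition split_index :: "nat \<Rightarrow> nat list \<Rightarrow> nat list \<times> nat list" where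
  "split_index n s = (let k = length (filter (\<lambda>j. j \<le> n) s)
     in (take k s, map (\<lambda>j. j - n) (drop k s)))"

definition join_index :: "nat \<Rightarrow> nat list \<times> nat list \<Rightarrow> nat list" where
  "join_index n p = fst p @ map (\<lambda>j. j + n) (snd p)"

definition coeff_indices :: "nat \<Rightarrow> nat \<Rightarrow> (nat list \<times> nat list) set" where
  "coeff_indices n d = (\<Union>k\<in>{0..d}. sorted_tuples n k \<times> sorted_tuples n (d - k))"

lemma coeff_families_eq: "coeff_families n d = (coeff_indices n d \<rightarrow>\<^sub>E UNIV)"
  by (simp add: coeff_families_def coeff_indices_def)

lemma sorted_filter_append:
  assumes "sorted (s :: nat list)"
  shows "filter (\<lambda>j. j \<le> n) s @ filter (\<lambda>j. \<not> j \<le> n) s = s"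
  using assms
proof (induction s)
  case (Cons j s)
  show ?case
  proof (cases "j \<le> n")
    case False
    then have "filter (\<lambda>j. j \<le> n) s = []" using Cons.prems by (auto simp: filter_empty_conv)
    with False Cons show ?thesis by simp
  qed (use Cons in simp)
qed simp

lemma split_index_filter:
  assumes "sorted s"
  shows "split_index n s = (filter (\<lambda>j. j \<le> n) s, map (\<lambda>j. j - n) (filter (\<lambda>j. \<not> j \<le> n) s))"
proof -
  define l where "l = filter (\<lambda>j. j \<le> n) s"
  define h where "h = filter (\<lambda>j. \<not> j \<le> n) s"
  have "s = l @ h" using sorted_filter_append[OF assms, of n] by (simp add: l_def h_def)
  then have "take (length l) s = l" "drop (length l) s = h" by auto
  then show ?thesis by (simp add: split_index_def Let_def l_def h_def)
qed

lemma join_split_index: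
  assumes "sorted s"
  shows "join_index n (split_index n s) = s"
proof -
  have "map ((\<lambda>j. j + n) \<circ> (\<lambda>j. j - n)) (filter (\<lambda>j. \<not> j \<le> n) s) = filter (\<lambda>j. \<not> j \<le> n) s"
    by (rule map_idI) auto
  then show ?thesis
    using sorted_filter_append[OF assms, of n] by (simp add: split_index_filter[OF assms] join_index_def)
qed

lemma join_index_in:
  assumes "p \<in> coeff_indices n d"
  shows "join_index n p \<in> sorted_tuples (2 * n) d"
proof -
  obtain "is" js where p: "p = (is, js)" by (cases p)
  then show ?thesis using assms
    by (fastforce simp: coeff_indices_def sorted_tuples_def index_tuples_def join_index_def
        sorted_append sorted_map intro: sorted_wrt_mono_rel)
qed

lemma split_join_index:
  assumes "p \<in> coeff_indices n d"
  shows "split_index n (join_index n p) = p"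
proof -
  obtain "is" js where p: "p = (is, js)" by (cases p)
  have "\<forall>i\<in>set is. i \<le> n" "\<forall>j\<in>set js. 1 \<le> j"
    using assms by (auto simp: p coeff_indices_def sorted_tuples_def index_tuples_def)
  then have "filter (\<lambda>j. j \<le> n) is = is" "filter (\<lambda>j. j \<le> n) (map (\<lambda>j. j + n) js) = []"
    by (auto simp: filter_empty_conv filter_id_conv simp del: filter_map)
  then show ?thesis by (simp add: p split_index_def join_index_def o_def del: filter_map)
qed

lemma split_index_in:
  assumes "s \<in> sorted_tuples (2 * n) d"
  shows "split_index n s \<in> coeff_indices n d"
proof -
  have s: "sorted s" "length s = d" "set s \<subseteq> {1..2 * n}"
    using assms by (auto simp: sorted_tuples_def index_tuples_def)
  have "length (filter (\<lambda>j. j \<le> n) s) + length (filter (\<lambda>j. \<not> j \<le> n) s) = d"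
    using s by (simp add: sum_length_filter_compl)
  moreover have "sorted (map (\<lambda>j. j - n) (filter (\<lambda>j. \<not> j \<le> n) s))"
    using sorted_wrt_filter[OF s(1), of "\<lambda>j. \<not> j \<le> n"]
    by (auto simp: sorted_map intro: sorted_wrt_mono_rel[rotated])
  moreover have "sorted (filter (\<lambda>j. j \<le> n) s)" using s(1) by (rule sorted_wrt_filter)
  ultimately show ?thesis using s(3)
    by (force simp: split_index_filter[OF s(1)] coeff_indices_def sorted_tuples_def index_tuples_def)
qed

lemma monomial_join_index:
  assumes "p \<in> coeff_indices n d"
  shows "monomial n (join_index n p) x = cnj (prod_list (map x (fst p))) * prod_list (map x (snd p))"
proof -
  obtain "is" js where p: "p = (is, js)" by (cases p)
  have sets: "set is \<subseteq> {1..n}" "set js \<subseteq> {1..n}"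
    using assms by (auto simp: p coeff_indices_def sorted_tuples_def index_tuples_def)
  have "prod_list (map (conj_stack n x) is) = cnj (prod_list (map x is))"
    using sets(1) by (induction "is") (auto simp: conj_stack_def)
  moreover have "prod_list (map (conj_stack n x \<circ> (\<lambda>j. j + n)) js) = prod_list (map x js)"
    using sets(2) by (induction js) (auto simp: conj_stack_def)
  ultimately show ?thesis by (simp add: p monomial_def join_index_def)
qed

lemma conj_form_eq_sum_monomials:
  assumes "x \<in> cvecs n"
  shows "conj_form n d a x = (\<Sum>s\<in>sorted_tuples (2 * n) d. a (split_index n s) * monomial n s x)"
proof -
  let ?t = "\<lambda>p. a p * cnj (prod_list (map x (fst p))) * prod_list (map x (snd p))"
  have "conj_form n d a x = (\<Sum>k\<in>{0..d}. \<Sum>p\<in>sorted_tuples n k \<times> sorted_tuples n (d - k). ?t p)"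
    using assms by (simp add: conj_form_def sum.cartesian_product case_prod_beta)
  also have "\<dots> = (\<Sum>p\<in>coeff_indices n d. ?t p)"
    unfolding coeff_indices_def
    by (rule sum.UNION_disjoint[symmetric])
      (auto simp: finite_sorted_tuples, auto simp: sorted_tuples_def index_tuples_def)
  also have "\<dots> = (\<Sum>s\<in>sorted_tuples (2 * n) d. a (split_index n s) * monomial n s x)"
    by (rule sum.reindex_bij_witness[where i = "split_index n" and j = "join_index n"])
      (auto simp: split_join_index join_index_in split_index_in monomial_join_index join_split_index
        sorted_tuples_sorted mult.assoc)
  finally show ?thesis .
qed

text \<open>
  This is what makes the definite description behind \<open>form_coeffs\<close> meaningful.
\<close>

lemma conj_form_inj:
  assumes a: "a \<in> coeff_families n d" and b: "b \<in> coeff_families n d"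
    and eq: "conj_form n d a = conj_form n d b"
  shows "a = b"
proof (rule PiE_ext[OF a[unfolded coeff_families_eq] b[unfolded coeff_families_eq]])
  fix p assume p: "p \<in> coeff_indices n d"
  have "a (split_index n s) - b (split_index n s) = 0" if "s \<in> sorted_tuples (2 * n) d" for s
  proof (rule monomials_linearly_independent[OF _ that])
    fix x assume "x \<in> cvecs n"
    then show "(\<Sum>s\<in>sorted_tuples (2 * n) d.
        (a (split_index n s) - b (split_index n s)) * monomial n s x) = 0"
      using fun_cong[OF eq, of x]
      by (simp add: conj_form_eq_sum_monomials left_diff_distrib sum_subtractf)
  qed
  from this[OF join_index_in[OF p]] show "a p = b p" by (simp add: split_join_index[OF p])
qed

lemma form_coeffs_conj_form:
  assumes "a \<in> coeff_families n d"
  shows "form_coeffs n d (conj_form n d a) = a"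
  unfolding form_coeffs_def using assms conj_form_inj by blast

section \<open>Forms of symmetric tensors\<close>

text \<open>
  Two tuples are rearrangements of each other exactly if their multisets agree, so
  symmetry can be used through an equation instead of permutations of positions.
\<close>

lemma symmetric_tensor_iff_mset:
  "symmetric_tensor m d F \<longleftrightarrow> F \<in> tensors m d \<and>
     (\<forall>is\<in>index_tuples m d. \<forall>js\<in>index_tuples m d. mset is = mset js \<longrightarrow> F is = F js)"
proof (intro iffI conjI ballI impI)
  fix "is" js
  assume F: "symmetric_tensor m d F" and js: "js \<in> index_tuples m d" and "mset is = mset js"
  then obtain p where "p permutes {..<length js}" "permute_list p js = is"
    by (metis mset_eq_permutation)
  then show "F is = F js" using F js by (auto simp: symmetric_tensor_def index_tuples_def)
next
  assume F: "F \<in> tensors m d \<and>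
     (\<forall>is\<in>index_tuples m d. \<forall>js\<in>index_tuples m d. mset is = mset js \<longrightarrow> F is = F js)"
  have "F (permute_list p js) = F js" if "js \<in> index_tuples m d" "p permutes {..<d}" for js p
  proof -
    have "mset (permute_list p js) = mset js" "length js = d"
      using that by (auto simp: index_tuples_def intro: mset_permute_list)
    moreover from this that(1) have "permute_list p js \<in> index_tuples m d"
      by (auto simp: index_tuples_def dest: mset_eq_setD)
    ultimately show ?thesis using F that(1) by blast
  qed
  then show "symmetric_tensor m d F" using F unfolding symmetric_tensor_def by blast
qed (simp add: symmetric_tensor_def)

lemma form_of_tensor_eq_sum_tuples:
  assumes "x \<in> cvecs n"
  shows "form_of_tensor n d F x = (\<Sum>js\<in>index_tuples (2 * n) d. F js * monomial n js x)"
proof -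
  have "(\<Prod>k<d. (replicate d (conj_stack n x) ! k) (js ! k)) = monomial n js x"
    if "js \<in> index_tuples (2 * n) d" for js
    using that by (simp add: monomial_def prod.list_conv_set_nth index_tuples_def atLeast0LessThan)
  then show ?thesis using assms by (simp add: form_of_tensor_def multilinear_form_def)
qed

abbreviation num_perms :: "nat list \<Rightarrow> nat" where
  "num_perms js \<equiv> card (permutations_of_multiset (mset js))"

lemma num_perms_pos: "num_perms js > 0"
  using permutations_of_multisetI[of js "mset js"] by (auto simp: card_gt_0_iff)

lemma sort_index_tuple: "js \<in> index_tuples m d \<Longrightarrow> sort js \<in> sorted_tuples m d"
  by (simp add: sorted_tuples_def index_tuples_def)

text \<open>
  The tuples that sort to \<open>s\<close> are the distinct permutations of \<open>s\<close>, and on all of them both the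
  entry of \<open>F\<close> and the monomial have the value that they have at \<open>s\<close>.
\<close>

lemma form_of_symmetric_tensor:
  assumes F: "symmetric_tensor (2 * n) d F" and x: "x \<in> cvecs n"
  shows "form_of_tensor n d F x
       = (\<Sum>s\<in>sorted_tuples (2 * n) d. (of_nat (num_perms s) * F s) * monomial n s x)"
proof -
  let ?T = "index_tuples (2 * n) d"
  let ?g = "\<lambda>js. F js * monomial n js x"
  have "form_of_tensor n d F x = sum ?g ?T"
    using x by (rule form_of_tensor_eq_sum_tuples)
  also have "\<dots> = (\<Sum>s\<in>sorted_tuples (2 * n) d. \<Sum>js\<in>{js \<in> ?T. sort js = s}. ?g js)"
    by (rule sum.group[symmetric])
      (auto simp: finite_index_tuples finite_sorted_tuples sort_index_tuple)
  also have "\<dots> = (\<Sum>s\<in>sorted_tuples (2 * n) d. (of_nat (num_perms s) * F s) * monomial n s x)"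
  proof (rule sum.cong[OF refl])
    fix s assume s: "s \<in> sorted_tuples (2 * n) d"
    have fibre: "{js \<in> ?T. sort js = s} = permutations_of_multiset (mset s)"
    proof (intro set_eqI iffI)
      fix js assume "js \<in> {js \<in> ?T. sort js = s}"
      then show "js \<in> permutations_of_multiset (mset s)"
        by (auto simp: permutations_of_multiset_def)
    next
      fix js assume "js \<in> permutations_of_multiset (mset s)"
      then have ms: "mset js = mset s" by (simp add: permutations_of_multiset_def)
      then show "js \<in> {js \<in> ?T. sort js = s}"
        using s mset_eq_setD[OF ms] mset_eq_length[OF ms] properties_for_sort[of s js]
        by (auto simp: sorted_tuples_def index_tuples_def)
    qed
    have "?g js = F s * monomial n s x" if "js \<in> permutations_of_multiset (mset s)" for js
    proof -
      have "mset js = mset s" using that by (simp add: permutations_of_multiset_def)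
      moreover have "js \<in> ?T" using that fibre by blast
      moreover have "s \<in> ?T" using s by (simp add: sorted_tuples_def)
      ultimately show ?thesis
        using F by (metis monomial_cong_mset symmetric_tensor_iff_mset)
    qed
    then show "(\<Sum>js\<in>{js \<in> ?T. sort js = s}. ?g js)
        = (of_nat (num_perms s) * F s) * monomial n s x"
      unfolding fibre by simp
  qed
  finally show ?thesis .
qed

lemma tensor_of_conj_form:
  assumes a: "a \<in> coeff_families n d" and js: "js \<in> index_tuples (2 * n) d"
  shows "tensor_of_form n d (conj_form n d a) js
       = a (split_index n (sort js)) / of_nat (num_perms js)"
proof -
  have "length (filter (\<lambda>j. j \<le> n) (sort js)) = length (filter (\<lambda>j. j \<le> n) js)"
    by (metis mset_filter mset_sort size_mset)
  then show ?thesis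
    using js by (simp add: tensor_of_form_def form_coeffs_conj_form[OF a] split_index_def Let_def)
qed

lemma symmetric_tensor_of_conj_form:
  assumes "a \<in> coeff_families n d"
  shows "symmetric_tensor (2 * n) d (tensor_of_form n d (conj_form n d a))"
  unfolding symmetric_tensor_iff_mset
proof (intro conjI ballI impI)
  show "tensor_of_form n d (conj_form n d a) \<in> tensors (2 * n) d"
    by (simp add: tensor_of_form_def tensors_def)
  fix "is" js
  assume *: "is \<in> index_tuples (2 * n) d" "js \<in> index_tuples (2 * n) d" "mset is = mset js"
  then have "sort is = sort js" by (metis mset_sort properties_for_sort sorted_sort)
  with * show "tensor_of_form n d (conj_form n d a) is = tensor_of_form n d (conj_form n d a) js"
    by (simp add: tensor_of_conj_form[OF assms])
qed

text \<open>
  The division by the number of permutations in \<open>tensor_of_form\<close> undoes the multiplication by it in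
  \<open>form_of_symmetric_tensor\<close>.
\<close>

lemma form_of_tensor_of_conj_form:
  assumes a: "a \<in> coeff_families n d"
  shows "form_of_tensor n d (tensor_of_form n d (conj_form n d a)) = conj_form n d a"
proof
  fix x
  show "form_of_tensor n d (tensor_of_form n d (conj_form n d a)) x = conj_form n d a x"
  proof (cases "x \<in> cvecs n")
    case True
    have "of_nat (num_perms s) * tensor_of_form n d (conj_form n d a) s = a (split_index n s)"
      if "s \<in> sorted_tuples (2 * n) d" for s
      using that num_perms_pos[of s]
      by (simp add: sorted_tuples_def tensor_of_conj_form[OF a] sort_key_id_if_sorted sorted_sort_id)
    then show ?thesis
      by (simp add: form_of_symmetric_tensor[OF symmetric_tensor_of_conj_form[OF a] True]
          conj_form_eq_sum_monomials[OF True])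
  qed (simp add: form_of_tensor_def conj_form_def)
qed

definition coeffs_of_tensor ::
    "nat \<Rightarrow> nat \<Rightarrow> (nat list \<Rightarrow> complex) \<Rightarrow> nat list \<times> nat list \<Rightarrow> complex" where
  "coeffs_of_tensor n d F =
     (\<lambda>p\<in>coeff_indices n d. of_nat (num_perms (join_index n p)) * F (join_index n p))"

lemma coeffs_of_tensor_in: "coeffs_of_tensor n d F \<in> coeff_families n d"
  by (simp add: coeffs_of_tensor_def coeff_families_eq)

lemma coeffs_of_tensor_split_index:
  assumes "s \<in> sorted_tuples (2 * n) d"
  shows "coeffs_of_tensor n d F (split_index n s) = of_nat (num_perms s) * F s"
  using assms split_index_in[OF assms]
  by (simp add: coeffs_of_tensor_def sorted_tuples_def join_split_index)

lemma form_of_symmetric_tensor_eq_conj_form: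
  assumes "symmetric_tensor (2 * n) d F"
  shows "form_of_tensor n d F = conj_form n d (coeffs_of_tensor n d F)"
proof
  fix x
  show "form_of_tensor n d F x = conj_form n d (coeffs_of_tensor n d F) x"
  proof (cases "x \<in> cvecs n")
    case True
    then show ?thesis
      by (simp add: form_of_symmetric_tensor[OF assms] conj_form_eq_sum_monomials
          coeffs_of_tensor_split_index)
  qed (simp add: form_of_tensor_def conj_form_def)
qed

lemma tensor_of_form_of_symmetric_tensor:
  assumes F: "symmetric_tensor (2 * n) d F"
  shows "tensor_of_form n d (form_of_tensor n d F) = F"
proof (rule extensionalityI[where A = "index_tuples (2 * n) d"])
  show "F \<in> extensional (index_tuples (2 * n) d)"
    using F by (simp add: symmetric_tensor_def tensors_def PiE_def)
  fix js assume js: "js \<in> index_tuples (2 * n) d"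
  have sorted: "sort js \<in> sorted_tuples (2 * n) d" using js by (rule sort_index_tuple)
  have "F (sort js) = F js"
    using F[unfolded symmetric_tensor_iff_mset] js sorted unfolding sorted_tuples_def
    by (metis (no_types, lifting) mem_Collect_eq mset_sort)
  then show "tensor_of_form n d (form_of_tensor n d F) js = F js"
    using num_perms_pos[of js]
    by (simp add: form_of_symmetric_tensor_eq_conj_form[OF F] coeffs_of_tensor_split_index[OF sorted]
        tensor_of_conj_form[OF coeffs_of_tensor_in js])
qed (simp add: tensor_of_form_def)

section \<open>Conjugation of tensors and real-valued forms\<close>

text \<open>
  On \<open>{1..2 * n}\<close> the condition \<open>\<bar>i - j\<bar> = n\<close> has exactly one solution \<open>i\<close> for each \<open>j\<close>, namely the
  index of the entry of the stacked vector that is conjugate to entry \<open>j\<close>.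
\<close>

definition swap_index :: "nat \<Rightarrow> nat \<Rightarrow> nat" where
  "swap_index n i = (if i \<le> n then i + n else i - n)"

definition conj_tensor :: "nat \<Rightarrow> nat \<Rightarrow> (nat list \<Rightarrow> complex) \<Rightarrow> nat list \<Rightarrow> complex" where
  "conj_tensor n d F = (\<lambda>js\<in>index_tuples (2 * n) d. cnj (F (map (swap_index n) js)))"

lemma swap_index_in: "i \<in> {1..2 * n} \<Longrightarrow> swap_index n i \<in> {1..2 * n}"
  by (auto simp: swap_index_def)

lemma swap_index_swap_index: "i \<in> {1..2 * n} \<Longrightarrow> swap_index n (swap_index n i) = i"
  by (auto simp: swap_index_def)

lemma map_swap_index_in:
  "js \<in> index_tuples (2 * n) d \<Longrightarrow> map (swap_index n) js \<in> index_tuples (2 * n) d"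
  using swap_index_in by (fastforce simp: index_tuples_def)

lemma map_swap_index_map_swap_index:
  "js \<in> index_tuples (2 * n) d \<Longrightarrow> map (swap_index n) (map (swap_index n) js) = js"
  unfolding map_map o_def index_tuples_def by (intro map_idI swap_index_swap_index) blast

lemma swap_index_iff:
  assumes "i \<in> {1..2 * n}" "j \<in> {1..2 * n}"
  shows "\<bar>int i - int j\<bar> = int n \<longleftrightarrow> i = swap_index n j"
  using assms by (auto simp: swap_index_def)

lemma tuple_swap_iff:
  assumes "is \<in> index_tuples (2 * n) d" "js \<in> index_tuples (2 * n) d"
  shows "(\<forall>k<d. \<bar>int (is ! k) - int (js ! k)\<bar> = int n) \<longleftrightarrow> is = map (swap_index n) js"
proof -
  have len: "length is = d" "length js = d" using assms by (auto simp: index_tuples_def)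
  have "\<bar>int (is ! k) - int (js ! k)\<bar> = int n \<longleftrightarrow> is ! k = swap_index n (js ! k)" if "k < d" for k
    using assms nth_mem[of k "is"] nth_mem[of k js] that len
    by (intro swap_index_iff) (auto simp: index_tuples_def simp del: nth_mem)
  then show ?thesis using len by (auto simp: list_eq_iff_nth_eq)
qed

text \<open>
  The quantification over pairs of tuples with entries \<open>n\<close> apart collapses, since the second tuple
  determines the first.
\<close>

lemma conj_super_symmetric_iff:
  "conj_super_symmetric n d F \<longleftrightarrow> symmetric_tensor (2 * n) d F \<and> conj_tensor n d F = F"
proof (cases "symmetric_tensor (2 * n) d F")
  case True
  then have ext: "F \<in> extensional (index_tuples (2 * n) d)"
    by (simp add: symmetric_tensor_def tensors_def PiE_def)
  have cnj_swap: "u = cnj v \<longleftrightarrow> cnj u = v" for u v :: complex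
    by auto
  have pointwise: "F (map (swap_index n) js) = cnj (F js) \<longleftrightarrow> conj_tensor n d F js = F js"
    if "js \<in> index_tuples (2 * n) d" for js
    unfolding conj_tensor_def restrict_apply'[OF that] by (rule cnj_swap)
  have "conj_super_symmetric n d F \<longleftrightarrow>
      (\<forall>js\<in>index_tuples (2 * n) d. F (map (swap_index n) js) = cnj (F js))"
    using True tuple_swap_iff map_swap_index_in unfolding conj_super_symmetric_def by metis
  also have "\<dots> \<longleftrightarrow> (\<forall>js\<in>index_tuples (2 * n) d. conj_tensor n d F js = F js)"
    using pointwise by blast
  also have "\<dots> \<longleftrightarrow> conj_tensor n d F = F"
  proof
    assume "\<forall>js\<in>index_tuples (2 * n) d. conj_tensor n d F js = F js"
    with ext show "conj_tensor n d F = F"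
      by (intro extensionalityI[where A = "index_tuples (2 * n) d"]) (simp_all add: conj_tensor_def)
  qed simp
  finally show ?thesis using True by simp
qed (simp add: conj_super_symmetric_def)

lemma symmetric_conj_tensor:
  assumes "symmetric_tensor (2 * n) d F"
  shows "symmetric_tensor (2 * n) d (conj_tensor n d F)"
  unfolding symmetric_tensor_iff_mset
proof (intro conjI ballI impI)
  show "conj_tensor n d F \<in> tensors (2 * n) d" by (simp add: conj_tensor_def tensors_def)
  fix "is" js
  assume *: "is \<in> index_tuples (2 * n) d" "js \<in> index_tuples (2 * n) d" "mset is = mset js"
  then have "mset (map (swap_index n) is) = mset (map (swap_index n) js)" by simp
  with assms have "F (map (swap_index n) is) = F (map (swap_index n) js)"
    unfolding symmetric_tensor_iff_mset
    using map_swap_index_in[OF *(1)] map_swap_index_in[OF *(2)] by blast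
  with * show "conj_tensor n d F is = conj_tensor n d F js" by (simp add: conj_tensor_def)
qed

lemma cnj_monomial:
  assumes "set js \<subseteq> {1..2 * n}"
  shows "cnj (monomial n js x) = monomial n (map (swap_index n) js) x"
  using assms by (induction js) (auto simp: monomial_def conj_stack_def swap_index_def)

text \<open>
  Conjugating a monomial swaps each of its indices, and swapping indices permutes the tuples, so
  the sum can be reindexed.
\<close>

lemma form_of_conj_tensor:
  assumes x: "x \<in> cvecs n"
  shows "form_of_tensor n d (conj_tensor n d F) x = cnj (form_of_tensor n d F x)"
proof -
  have "cnj (form_of_tensor n d F x)
      = (\<Sum>js\<in>index_tuples (2 * n) d. cnj (F js) * monomial n (map (swap_index n) js) x)"
    using x by (simp add: form_of_tensor_eq_sum_tuples cnj_monomial index_tuples_def)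
  also have "\<dots> = (\<Sum>js\<in>index_tuples (2 * n) d. conj_tensor n d F js * monomial n js x)"
    by (rule sum.reindex_bij_witness[where i = "map (swap_index n)" and j = "map (swap_index n)"])
      (auto simp: map_swap_index_in map_swap_index_map_swap_index conj_tensor_def simp del: map_map)
  finally show ?thesis using x by (simp add: form_of_tensor_eq_sum_tuples)
qed

text \<open>
  A form is real-valued if it agrees with its conjugate, which is the form of \<open>conj_tensor n d F\<close>.
  As both tensors are symmetric, equality of the forms is equality of the tensors.
\<close>

lemma real_valued_form_iff:
  assumes F: "symmetric_tensor (2 * n) d F"
  shows "real_valued_form n (form_of_tensor n d F) \<longleftrightarrow> conj_super_symmetric n d F"
proof -
  have "form_of_tensor n d F x \<in> \<real> \<longleftrightarrow>
      form_of_tensor n d (conj_tensor n d F) x = form_of_tensor n d F x" if "x \<in> cvecs n" for x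
    unfolding Reals_cnj_iff form_of_conj_tensor[OF that] by (rule refl)
  then have "real_valued_form n (form_of_tensor n d F) \<longleftrightarrow>
      (\<forall>x\<in>cvecs n. form_of_tensor n d (conj_tensor n d F) x = form_of_tensor n d F x)"
    unfolding real_valued_form_def by blast
  also have "\<dots> \<longleftrightarrow> form_of_tensor n d (conj_tensor n d F) = form_of_tensor n d F"
  proof
    assume eq: "\<forall>x\<in>cvecs n. form_of_tensor n d (conj_tensor n d F) x = form_of_tensor n d F x"
    have ext: "form_of_tensor n d F' \<in> extensional (cvecs n)" for F'
      by (simp add: form_of_tensor_def)
    show "form_of_tensor n d (conj_tensor n d F) = form_of_tensor n d F"
      using eq by (intro extensionalityI[OF ext ext]) blast
  next
    assume "form_of_tensor n d (conj_tensor n d F) = form_of_tensor n d F"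
    from fun_cong[OF this]
    show "\<forall>x\<in>cvecs n. form_of_tensor n d (conj_tensor n d F) x = form_of_tensor n d F x" by blast
  qed
  also have "\<dots> \<longleftrightarrow> conj_tensor n d F = F"
  proof
    assume "form_of_tensor n d (conj_tensor n d F) = form_of_tensor n d F"
    then have "tensor_of_form n d (form_of_tensor n d (conj_tensor n d F))
        = tensor_of_form n d (form_of_tensor n d F)" by (rule arg_cong)
    then show "conj_tensor n d F = F"
      unfolding tensor_of_form_of_symmetric_tensor[OF F]
        tensor_of_form_of_symmetric_tensor[OF symmetric_conj_tensor[OF F]] .
  qed simp
  finally show ?thesis unfolding conj_super_symmetric_iff using F by blast
qed

theorem proposition3p11:
  fixes n d :: nat
  shows "(\<forall>F. conj_super_symmetric n d F \<longrightarrow>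
            general_conj_form n d (form_of_tensor n d F) \<and>
            real_valued_form n (form_of_tensor n d F) \<and>
            tensor_of_form n d (form_of_tensor n d F) = F) \<and>
         (\<forall>f. general_conj_form n d f \<and> real_valued_form n f \<longrightarrow>
            conj_super_symmetric n d (tensor_of_form n d f) \<and>
            form_of_tensor n d (tensor_of_form n d f) = f)"
proof (intro conjI allI impI)
  fix F assume css: "conj_super_symmetric n d F"
  then have F: "symmetric_tensor (2 * n) d F" by (simp add: conj_super_symmetric_def)
  show "general_conj_form n d (form_of_tensor n d F)"
    using form_of_symmetric_tensor_eq_conj_form[OF F] coeffs_of_tensor_in
    unfolding general_conj_form_def by blast
  show "real_valued_form n (form_of_tensor n d F)"
    using css by (simp add: real_valued_form_iff[OF F])
  show "tensor_of_form n d (form_of_tensor n d F) = F"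
    by (rule tensor_of_form_of_symmetric_tensor[OF F])
next
  fix f assume f: "general_conj_form n d f \<and> real_valued_form n f"
  then obtain a where a: "a \<in> coeff_families n d" "f = conj_form n d a"
    unfolding general_conj_form_def by blast
  show inverse: "form_of_tensor n d (tensor_of_form n d f) = f"
    unfolding a(2) by (rule form_of_tensor_of_conj_form[OF a(1)])
  have "symmetric_tensor (2 * n) d (tensor_of_form n d f)"
    unfolding a(2) by (rule symmetric_tensor_of_conj_form[OF a(1)])
  from real_valued_form_iff[OF this] show "conj_super_symmetric n d (tensor_of_form n d f)"
    unfolding inverse using f by blast
qed

end
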